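(* Let $(X,T)$ and $(Y,S)$ be ergodically supported topological dynamical systems with $T$ and $S$ invertible, and suppose $(X,T)$ and $(Y,S)$ are almost topologically conjugate. Then there exist a $T$-invariant set $\tilde X\subseteq X$ and an $S$-invariant set $\tilde Y\subseteq Y$, such that $\tilde X$ has full measure for every ergodically supported measure of $(X,T)$ and $\tilde Y$ has full measure for every ergodically supported measure of $(Y,S)$, and a homeomorphism $\varphi:\tilde X\to\tilde Y$ (subspace topologies) with $\varphi\circ T=S\circ\varphi$ on $\tilde X$; i.e. $\varphi$ is a topological conjugacy between $(\tilde X,T|_{\tilde X})$ and $(\tilde Y,S|_{\tilde Y})$.
   Context: A topological dynamical system $(X,T)$ is a compact metric space $X$ with a continuous surjection $T:X\to X$. A probability measure on $X$ is ergodically supported (for $(X,T)$) if it is $T$-invariant and ergodic and assigns positive measure to every nonempty open subset of $X$; $(X,T)$ is ergodically supported if such a measure exists. A set $E\subseteq X$ is universally null if $\mu(E)=0$ for every ergodically supported measure $\mu$. The inverse limit system of $(X,T)$ is $X^T:=\{(x_i)_{i\in\mathbb Z}\in X^{\mathbb Z}: x_{i+1}=T(x_i)\ \forall i\}$ with the standard compact metric (induced from the product topology) and the shift $\sigma_{X^T}((x_i)_i)=(x_{i+1})_i$. A Markov shift is a closed shift-invariant subset $\Lambda$ of $\mathcal A^{\mathbb Z}$ ($\mathcal A$ finite) given by bi-infinite walks on a finite directed graph, with the shift map $\sigma$. Two ergodically supported systems $(X,T)$, $(Y,S)$ are almost topologically conjugate if there exist an ergodically supported Markov shift $(\Lambda,\sigma)$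 and continuous surjections $f_T:\Lambda\to X^T$, $f_S:\Lambda\to Y^S$ such that (i) $\sigma_{X^T}\circ f_T=f_T\circ\sigma$ and $\sigma_{Y^S}\circ f_S=f_S\circ\sigma$; (ii) there are a $\sigma_{X^T}$-invariant universally null set $M_2\subset X^T$ and a $\sigma_{Y^S}$-invariant universally null set $P_2\subset Y^S$ such that $f_T:\Lambda\setminus M_1\to X^T\setminus M_2$ and $f_S:\Lambda\setminus P_1\to Y^S\setminus P_2$ are one-to-one, where $M_1=f_T^{-1}(M_2)$, $P_1=f_S^{-1}(P_2)$. *)

theory Defs
  imports "HOL-Probability.Probability"
begin

definition tds :: "'a::topological_space set \<Rightarrow> ('a \<Rightarrow> 'a) \<Rightarrow> bool" where
  "tds X T \<longleftrightarrow> compact X \<and> continuous_on X T \<and> T ` X = X"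

definition erg_supp_measure :: "'a::topological_space set \<Rightarrow> ('a \<Rightarrow> 'a) \<Rightarrow> 'a measure \<Rightarrow> bool" where
  "erg_supp_measure X T \<mu> \<longleftrightarrow>
     prob_space \<mu> \<and> space \<mu> = X \<and> sets \<mu> = sets (restrict_space borel X) \<and>
     T \<in> \<mu> \<rightarrow>\<^sub>M \<mu> \<and> distr \<mu> \<mu> T = \<mu> \<and>
     (\<forall>A \<in> sets \<mu>. T -` A \<inter> X = A \<longrightarrow> measure \<mu> A = 0 \<or> measure \<mu> A = 1) \<and>
     (\<forall>U. openin (top_of_set X) U \<and> U \<noteq> {} \<longrightarrow> emeasure \<mu> U > 0)"

definition erg_supported :: "'a::topological_space set \<Rightarrow> ('a \<Rightarrow> 'a) \<Rightarrow> bool" where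
  "erg_supported X T \<longleftrightarrow> tds X T \<and> (\<exists>\<mu>. erg_supp_measure X T \<mu>)"

definition univ_null :: "'a::topological_space set \<Rightarrow> ('a \<Rightarrow> 'a) \<Rightarrow> 'a set \<Rightarrow> bool" where
  "univ_null X T E \<longleftrightarrow> E \<subseteq> X \<and>
     (\<forall>\<mu>. erg_supp_measure X T \<mu> \<longrightarrow> E \<in> null_sets (completion \<mu>))"

text \<open>Inverse limit and shift; int => 'a carries the product topology.\<close>
definition inv_lim :: "'a set \<Rightarrow> ('a \<Rightarrow> 'a) \<Rightarrow> (int \<Rightarrow> 'a) set" where
  "inv_lim X T = {x. (\<forall>i. x i \<in> X) \<and> (\<forall>i. x (i + 1) = T (x i))}"

definition shift :: "(int \<Rightarrow> 'a) \<Rightarrow> (int \<Rightarrow> 'a)" where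
  "shift x = (\<lambda>i. x (i + 1))"

text \<open>Markov shift: bi-infinite walks on the finite directed graph with edge set E
  (vertices are natural numbers, alphabet = vertices, discrete topology).\<close>
definition markov_shift :: "(nat \<times> nat) set \<Rightarrow> (int \<Rightarrow> nat) set" where
  "markov_shift E = {x. \<forall>i. (x i, x (i + 1)) \<in> E}"

definition almost_top_conj ::
  "'a::metric_space set \<Rightarrow> ('a \<Rightarrow> 'a) \<Rightarrow> 'b::metric_space set \<Rightarrow> ('b \<Rightarrow> 'b) \<Rightarrow> bool" where
  "almost_top_conj X T Y S \<longleftrightarrow>
     erg_supported X T \<and> erg_supported Y S \<and>
     (\<exists>E fT fS M2 P2.
        finite E \<and> erg_supported (markov_shift E) shift \<and>
        continuous_on (markov_shift E) fT \<and> fT ` markov_shift E = inv_lim X T \<and>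
        continuous_on (markov_shift E) fS \<and> fS ` markov_shift E = inv_lim Y S \<and>
        (\<forall>x \<in> markov_shift E. fT (shift x) = shift (fT x)) \<and>
        (\<forall>x \<in> markov_shift E. fS (shift x) = shift (fS x)) \<and>
        M2 \<subseteq> inv_lim X T \<and> shift ` M2 = M2 \<and> univ_null (inv_lim X T) shift M2 \<and>
        P2 \<subseteq> inv_lim Y S \<and> shift ` P2 = P2 \<and> univ_null (inv_lim Y S) shift P2 \<and>
        inj_on fT (markov_shift E - fT -` M2) \<and>
        inj_on fS (markov_shift E - fS -` P2))"

end

theory Submission
  imports Defs
begin

text \<open>
  For invertible \<open>T\<close> the zeroth coordinate identifies the inverse limit with \<open>X\<close>, so the Markov
  shift \<open>\<Lambda>\<close> factors onto \<open>X\<close> and \<open>Y\<close> by maps \<open>f\<close>, \<open>g\<close> that are injective off the preimages of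
  universally null sets \<open>M\<close>, \<open>P\<close>. As \<open>f\<close> and \<open>g\<close> are closed maps, they restrict to
  homeomorphisms there, and the conjugacy is \<open>g \<circ> f\<^sup>-\<^sup>1\<close> on the image of the points of \<open>\<Lambda>\<close>
  that avoid both preimages. The exceptional set in \<open>X\<close> is null because every ergodically
  supported \<open>\<mu>\<close> on \<open>X\<close> lifts along \<open>f\<close> to an ergodically supported measure on \<open>\<Lambda>\<close>. The lift has
  full support: an open set \<open>U\<close> of lift measure zero lies in the preimage of \<open>M\<close>, which is null
  for any ergodically supported measure of \<open>\<Lambda>\<close>, and one exists by assumption.
\<close>

section \<open>Ergodically supported measures under factor maps\<close>

lemma erg_supp_measureD:
  assumes "erg_supp_measure X T \<mu>"
  shows "prob_space \<mu>" "space \<mu> = X" "sets \<mu> = sets (restrict_space borel X)"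
    "T \<in> \<mu> \<rightarrow>\<^sub>M \<mu>" "distr \<mu> \<mu> T = \<mu>"
    "\<And>A. A \<in> sets \<mu> \<Longrightarrow> T -` A \<inter> X = A \<Longrightarrow> measure \<mu> A = 0 \<or> measure \<mu> A = 1"
    "\<And>U. openin (top_of_set X) U \<Longrightarrow> U \<noteq> {} \<Longrightarrow> emeasure \<mu> U > 0"
  using assms unfolding erg_supp_measure_def by auto

lemma continuous_on_measurable_restrict_borel:
  assumes "continuous_on X k" "k ` X \<subseteq> Z"
  shows "k \<in> restrict_space borel X \<rightarrow>\<^sub>M restrict_space borel Z"
  using assms
  by (intro measurable_restrict_space2 borel_measurable_continuous_on_restrict)
     (auto simp: space_restrict_space)

lemma openin_sets_restrict_borel:
  "openin (top_of_set X) U \<Longrightarrow> U \<in> sets (restrict_space borel X)"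
  by (auto simp: openin_open sets_restrict_space)

text \<open>Invariance follows from \<open>k \<circ> T = R \<circ> k\<close> on \<open>X\<close>.
  Preimages of invariant sets are invariant, which transfers ergodicity. Surjectivity of
  \<open>k\<close> keeps preimages of nonempty open sets nonempty, which transfers full
  support.\<close>

lemma erg_supp_measure_distr:
  assumes \<mu>: "erg_supp_measure X T \<mu>"
    and k: "continuous_on X k" "k ` X = Z"
    and R: "continuous_on Z R" "R ` Z \<subseteq> Z"
    and eq: "\<And>x. x \<in> X \<Longrightarrow> k (T x) = R (k x)"
  shows "erg_supp_measure Z R (distr \<mu> (restrict_space borel Z) k)"
proof -
  note D = erg_supp_measureD[OF \<mu>]
  interpret prob_space \<mu> by fact
  let ?B = "restrict_space borel Z" let ?\<nu> = "distr \<mu> ?B k"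
  have spB: "space ?B = Z" by (simp add: space_restrict_space)
  have km: "k \<in> \<mu> \<rightarrow>\<^sub>M ?B"
    using continuous_on_measurable_restrict_borel[OF k(1), of Z] k(2) D(3)
    by (simp cong: measurable_cong_sets)
  have Rm: "R \<in> ?B \<rightarrow>\<^sub>M ?B"
    by (rule continuous_on_measurable_restrict_borel[OF R])
  have TX: "T x \<in> X" if "x \<in> X" for x
    using measurable_space[OF D(4)] that D(2) by auto
  have "distr ?\<nu> ?\<nu> R = distr ?\<nu> ?B R" by (rule distr_cong) auto
  also have "\<dots> = distr \<mu> ?B (R \<circ> k)" by (rule distr_distr[OF Rm km])
  also have "\<dots> = distr \<mu> ?B (k \<circ> T)" by (rule distr_cong) (auto simp: eq D(2))
  also have "\<dots> = distr (distr \<mu> \<mu> T) ?B k" by (rule distr_distr[OF km D(4), symmetric])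
  finally have inv: "distr ?\<nu> ?\<nu> R = ?\<nu>" by (simp add: D(5))
  have erg: "measure ?\<nu> A = 0 \<or> measure ?\<nu> A = 1"
    if A: "A \<in> sets ?\<nu>" "R -` A \<inter> Z = A" for A
  proof -
    have "T -` (k -` A \<inter> X) \<inter> X = k -` (R -` A \<inter> Z) \<inter> X"
      using eq TX k(2) by auto
    then have "measure \<mu> (k -` A \<inter> X) = 0 \<or> measure \<mu> (k -` A \<inter> X) = 1"
      using A measurable_sets[OF km, of A] D(2) by (intro D(6)) auto
    then show ?thesis using A km D(2) by (simp add: measure_distr)
  qed
  have supp: "emeasure ?\<nu> U > 0" if U: "openin (top_of_set Z) U" "U \<noteq> {}" for U
  proof -
    have "openin (top_of_set X) (X \<inter> k -` U)"
      using continuous_openin_preimage[OF k(1) _ U(1)] k(2) by auto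
    moreover have "X \<inter> k -` U \<noteq> {}"
      using U k(2) openin_imp_subset[OF U(1)] by blast
    ultimately have "emeasure \<mu> (X \<inter> k -` U) > 0" by (rule D(7))
    then show ?thesis
      using km openin_sets_restrict_borel[OF U(1)] D(2)
      by (simp add: emeasure_distr Int_commute)
  qed
  show ?thesis unfolding erg_supp_measure_def
    using prob_space_distr[OF km] inv erg supp Rm spB
    by (auto cong: measurable_cong_sets)
qed

text \<open>Every ergodically supported measure on \<open>X\<close> pushes forward to one on
  \<open>Z\<close>. For the latter \<open>M\<close> is covered by a measurable null set
  \<open>N\<close>, and the preimage of \<open>N\<close> is null upstairs.\<close>

lemma univ_null_vimage:
  assumes k: "continuous_on X k" "k ` X = Z"
    and R: "continuous_on Z R" "R ` Z \<subseteq> Z"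
    and eq: "\<And>x. x \<in> X \<Longrightarrow> k (T x) = R (k x)"
    and M: "univ_null Z R M"
  shows "univ_null X T (X \<inter> k -` M)"
  unfolding univ_null_def
proof (intro conjI allI impI)
  fix \<mu> assume \<mu>: "erg_supp_measure X T \<mu>"
  note D = erg_supp_measureD[OF \<mu>]
  have km: "k \<in> \<mu> \<rightarrow>\<^sub>M restrict_space borel Z"
    using continuous_on_measurable_restrict_borel[OF k(1), of Z] k(2) D(3)
    by (simp cong: measurable_cong_sets)
  have "M \<in> null_sets (completion (distr \<mu> (restrict_space borel Z) k))"
    using M erg_supp_measure_distr[OF \<mu> k R eq] by (auto simp: univ_null_def)
  then obtain N where N: "N \<in> null_sets (distr \<mu> (restrict_space borel Z) k)" "M \<subseteq> N"
    unfolding null_sets_completion_iff2 by blast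
  then have "k -` N \<inter> X \<in> null_sets \<mu>"
    using km D(2) by (simp add: null_sets_distr_iff)
  then show "X \<inter> k -` M \<in> null_sets (completion \<mu>)"
    unfolding null_sets_completion_iff2 by (rule rev_bexI) (use N(2) in auto)
qed auto

text \<open>
  Almost invariance is upgraded to strict invariance by replacing \<open>B\<close> with the set of points
  whose forward orbit is eventually in \<open>B\<close>.
\<close>

lemma erg_supp_measure_AE_invariant:
  assumes \<mu>: "erg_supp_measure X T \<mu>"
    and B: "B \<in> sets \<mu>" and inv: "AE x in \<mu>. T x \<in> B \<longleftrightarrow> x \<in> B"
  shows "measure \<mu> B = 0 \<or> measure \<mu> B = 1"
proof -
  note D = erg_supp_measureD[OF \<mu>]
  have Tn: "(T ^^ n) \<in> \<mu> \<rightarrow>\<^sub>M \<mu>" for n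
    by (rule measurable_compose_n[OF D(4)])
  have *: "AE x in \<mu>. (T ^^ n) x \<in> B \<longleftrightarrow> x \<in> B" for n
  proof (induction n)
    case (Suc n)
    \<comment> \<open>Since \<open>T\<close> preserves \<mu>, the induction hypothesis also holds at
      \<open>T x\<close> for almost every \<open>x\<close>.\<close>
    have "AE x in distr \<mu> \<mu> T. (T ^^ n) x \<in> B \<longleftrightarrow> x \<in> B" unfolding D(5) by (rule Suc)
    from AE_distrD[OF D(4) this] inv show ?case
      by eventually_elim (simp add: funpow_swap1)
  qed simp
  define C where "C = {x \<in> space \<mu>. \<exists>m. \<forall>n\<ge>m. (T ^^ n) x \<in> B}"
  have C: "C \<in> sets \<mu>"
    unfolding C_def using B Tn by measurable
  have "AE x in \<mu>. \<forall>n. (T ^^ n) x \<in> B \<longleftrightarrow> x \<in> B"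
    using * by (simp add: AE_all_countable)
  then have "AE x in \<mu>. x \<in> C \<longleftrightarrow> x \<in> B"
    using AE_space by eventually_elim (auto simp: C_def)
  then have CB: "measure \<mu> C = measure \<mu> B"
    by (rule measure_eq_AE) (use B C in auto)
  have "(\<exists>m. \<forall>n\<ge>m. (T ^^ n) (T x) \<in> B) \<longleftrightarrow> (\<exists>m. \<forall>n\<ge>m. (T ^^ n) x \<in> B)" for x
  proof
    assume "\<exists>m. \<forall>n\<ge>m. (T ^^ n) (T x) \<in> B"
    then obtain m where m: "\<forall>n\<ge>m. (T ^^ Suc n) x \<in> B" by (auto simp: funpow_swap1)
    then have "\<forall>n\<ge>Suc m. (T ^^ n) x \<in> B" by (metis Suc_le_D Suc_le_mono)
    then show "\<exists>m. \<forall>n\<ge>m. (T ^^ n) x \<in> B" by blast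
  next
    assume "\<exists>m. \<forall>n\<ge>m. (T ^^ n) x \<in> B"
    then obtain m where m: "\<forall>n\<ge>m. (T ^^ n) x \<in> B" by auto
    then have "\<forall>n\<ge>m. (T ^^ Suc n) x \<in> B" using le_SucI by blast
    then show "\<exists>m. \<forall>n\<ge>m. (T ^^ n) (T x) \<in> B" by (auto simp: funpow_swap1)
  qed
  then have "T -` C \<inter> X = C"
    using measurable_space[OF D(4)] D(2) by (auto simp: C_def)
  with D(6)[OF C] CB show ?thesis by simp
qed

section \<open>Inverting a factor map off a null set\<close>

text \<open>The removed set is a full preimage, so the image of \<open>?L \<inter> D\<close> is the
  trace on \<open>X - N\<close> of the image of \<open>L \<inter> D\<close>. For closed
  \<open>D\<close> the latter is compact, hence closed in a Hausdorff space. Thus the restriction is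
  an injective closed map.\<close>

lemma homeomorphism_restrict_saturated:
  fixes f :: "'l::topological_space \<Rightarrow> 'a::t2_space"
  assumes "compact L" "continuous_on L f" "f ` L = X" and "inj_on f (L - f -` N)"
  shows "homeomorphism (L - f -` N) (X - N) f (inv_into (L - f -` N) f)"
proof -
  let ?L = "L - f -` N"
  have im: "f ` ?L = X - N" using assms(3) by auto
  have closed_map: "closedin (top_of_set (X - N)) (f ` C)" if C: "closedin (top_of_set ?L) C" for C
  proof -
    obtain D where D: "closed D" "C = ?L \<inter> D" using C by (auto simp: closedin_closed)
    have "compact (f ` (L \<inter> D))"
      by (intro compact_continuous_image continuous_on_subset[OF assms(2)] compact_Int_closed)
         (use assms D in auto)
    then have "closed (f ` (L \<inter> D))" by (rule compact_imp_closed)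
    moreover have "f ` C = (X - N) \<inter> f ` (L \<inter> D)" using D(2) assms(3) by auto
    ultimately show ?thesis by (auto simp: closedin_closed)
  qed
  obtain g where g: "homeomorphism ?L (X - N) f g"
    using homeomorphism_injective_closed_map[OF _ im assms(4), of thesis] closed_map
      continuous_on_subset[OF assms(2)] by auto
  have "g y = inv_into ?L f y" if "y \<in> X - N" for y
    using g that assms(4) unfolding homeomorphism_def
    by (metis (no_types, lifting) imageI inv_into_f_f)
  with g show ?thesis by (auto intro: homeomorphism_cong)
qed

text \<open>The opposite direction to \<open>univ_null_vimage\<close>. Almost injectivity provides a
  measurable section \<open>h\<close> of \<open>f\<close> off a null set. It lifts \<mu> to an
  ergodically supported measure on \<open>L\<close>, for which \<open>Q\<close> is null.\<close>

lemma univ_null_image: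
  fixes f :: "'l::topological_space \<Rightarrow> 'a::t2_space"
  assumes L: "erg_supported L s" and X: "tds X T"
    and f: "continuous_on L f" "f ` L = X"
    and eq: "\<And>l. l \<in> L \<Longrightarrow> f (s l) = T (f l)"
    and M: "univ_null X T M" and inj: "inj_on f (L - f -` M)"
    and Q: "univ_null L s Q"
  shows "univ_null X T (f ` Q)"
  unfolding univ_null_def
proof (intro conjI allI impI)
  show "f ` Q \<subseteq> X" using Q f by (auto simp: univ_null_def)
  fix \<mu> assume \<mu>: "erg_supp_measure X T \<mu>"
  note D = erg_supp_measureD[OF \<mu>]
  interpret prob_space \<mu> by fact
  have cL: "compact L" and cs: "continuous_on L s" and sL: "s ` L = L"
    using L by (auto simp: erg_supported_def tds_def)
  have cT: "continuous_on X T" and TX: "T ` X = X" using X by (auto simp: tds_def)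
  from L obtain \<kappa> where \<kappa>: "erg_supp_measure L s \<kappa>" by (auto simp: erg_supported_def)
  have "M \<in> null_sets (completion \<mu>)" using M \<mu> by (auto simp: univ_null_def)
  \<comment> \<open>\<open>M\<close> is null only in the completion. A measurable null superset
    preserves injectivity and lets \<open>h\<close> below be measurable.\<close>
  then obtain N where N: "N \<in> null_sets \<mu>" "M \<subseteq> N"
    unfolding null_sets_completion_iff2 by blast
  have injN: "inj_on f (L - f -` N)" by (rule inj_on_subset[OF inj]) (use N in auto)
  define h0 where "h0 = inv_into (L - f -` N) f"
  have hom: "homeomorphism (L - f -` N) (X - N) f h0"
    unfolding h0_def by (rule homeomorphism_restrict_saturated[OF cL f injN])
  have "X \<noteq> {}" using not_empty D(2) by simp
  then obtain l0 where l0: "l0 \<in> L" using f by auto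
  \<comment> \<open>\<open>N\<close> is null, so the value on it does not affect the lift; a
    constant point of \<open>L\<close> makes \<open>h\<close> total and measurable.\<close>
  define h where "h x = (if x \<in> X - N then h0 x else l0)" for x
  have hL: "h x \<in> L" for x
    using hom l0 by (auto simp: h_def homeomorphism_def)
  have fh: "f (h x) = x" if "x \<in> X" "x \<notin> N" for x
    using hom that by (auto simp: h_def homeomorphism_def)
  have hf: "h (f l) = l" if "l \<in> L" "f l \<notin> N" for l
    using hom that f(2) by (auto simp: h_def homeomorphism_def)
  let ?B = "restrict_space borel L" let ?\<nu> = "distr \<mu> ?B h"
  have spB: "space ?B = L" by (simp add: space_restrict_space)
  have hm: "h \<in> \<mu> \<rightarrow>\<^sub>M ?B"
  proof (rule measurableI)
    show "h x \<in> space ?B" for x using hL spB by simp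
    fix A assume A: "A \<in> sets ?B"
    have "h0 \<in> restrict_space borel (X - N) \<rightarrow>\<^sub>M ?B"
      using hom by (intro continuous_on_measurable_restrict_borel) (auto simp: homeomorphism_def)
    from measurable_sets[OF this A] obtain B where
      B: "B \<in> sets borel" "h0 -` A \<inter> (X - N) = (X - N) \<inter> B"
      by (auto simp: space_restrict_space sets_restrict_space)
    have "X \<inter> B \<in> sets \<mu>" using B D(3) by (auto simp: sets_restrict_space)
    moreover have "N \<in> sets \<mu>" "N \<subseteq> X"
      using null_setsD2[OF N(1)] sets.sets_into_space[of N \<mu>] D(2) by auto
    moreover have "h -` A \<inter> X = (X \<inter> B - N) \<union> (if l0 \<in> A then N else {})"
      using B(2) \<open>N \<subseteq> X\<close> by (auto simp: h_def split: if_splits)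
    ultimately show "h -` A \<inter> space \<mu> \<in> sets \<mu>" using D(2) by auto
  qed
  have sm: "s \<in> ?B \<rightarrow>\<^sub>M ?B"
    using cs sL by (intro continuous_on_measurable_restrict_borel) auto
  have nN: "AE x in \<mu>. x \<notin> N" using N(1) by (rule AE_not_in)
  \<comment> \<open>For almost every \<open>x\<close> both \<open>x\<close> and \<open>T x\<close>
    avoid \<open>N\<close>. Then \<open>s (h x)\<close> lies over \<open>T x\<close>, where the
    fibre is a single point, namely \<open>h (T x)\<close>.\<close>
  have "AE x in distr \<mu> \<mu> T. x \<notin> N" unfolding D(5) by (rule nN)
  from AE_distrD[OF D(4) this] nN AE_space
  have h_eq: "AE x in \<mu>. h (T x) = s (h x)"
  proof eventually_elim
    case (elim x)
    have "f (s (h x)) = T x" using eq[OF hL] fh elim D(2) by simp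
    moreover have "s (h x) \<in> L" using sL hL by blast
    ultimately show ?case using hf elim by metis
  qed
  have "distr ?\<nu> ?\<nu> s = distr ?\<nu> ?B s" by (rule distr_cong) auto
  also have "\<dots> = distr \<mu> ?B (s \<circ> h)" by (rule distr_distr[OF sm hm])
  also have "\<dots> = distr \<mu> ?B (h \<circ> T)"
    using h_eq measurable_comp[OF hm sm] measurable_comp[OF D(4) hm]
    by (intro distr_cong_AE) auto
  also have "\<dots> = distr (distr \<mu> \<mu> T) ?B h" by (rule distr_distr[OF hm D(4), symmetric])
  finally have inv: "distr ?\<nu> ?\<nu> s = ?\<nu>" by (simp add: D(5))
  have erg: "measure ?\<nu> A = 0 \<or> measure ?\<nu> A = 1"
    if A: "A \<in> sets ?\<nu>" "s -` A \<inter> L = A" for A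
  proof -
    have sA: "s l \<in> A \<longleftrightarrow> l \<in> A" if "l \<in> L" for l using A(2) that by blast
    \<comment> \<open>\<open>h\<close> is equivariant only almost everywhere, so an invariant set
      pulls back to an almost invariant one.\<close>
    have "AE x in \<mu>. T x \<in> h -` A \<inter> X \<longleftrightarrow> x \<in> h -` A \<inter> X"
      using h_eq AE_space
    proof eventually_elim
      case (elim x)
      have "T x \<in> X" using elim D(2) TX by auto
      then show ?case using elim D(2) sA[OF hL] by simp
    qed
    then have "measure \<mu> (h -` A \<inter> X) = 0 \<or> measure \<mu> (h -` A \<inter> X) = 1"
      using measurable_sets[OF hm, of A] A D(2)
      by (intro erg_supp_measure_AE_invariant[OF \<mu>]) auto
    then show ?thesis using A hm D(2) by (simp add: measure_distr)
  qed
  have supp: "emeasure ?\<nu> U > 0" if U: "openin (top_of_set L) U" "U \<noteq> {}" for U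
  proof (rule ccontr)
    assume "\<not> emeasure ?\<nu> U > 0"
    then have "U \<in> null_sets ?\<nu>"
      using openin_sets_restrict_borel[OF U(1)] by (auto simp: null_sets_def)
    then have hU: "h -` U \<inter> X \<in> null_sets \<mu>"
      using hm D(2) by (simp add: null_sets_distr_iff)
    have "closedin (top_of_set L) (L - U)" using U(1) by (simp add: closedin_diff)
    then obtain K where K: "closed K" "L - U = L \<inter> K" by (auto simp: closedin_closed)
    have "compact (f ` (L - U))"
      unfolding K(2)
      by (intro compact_continuous_image continuous_on_subset[OF f(1)] compact_Int_closed)
         (use cL K in auto)
    then have "closed (f ` (L - U))" by (rule compact_imp_closed)
    then have op: "openin (top_of_set X) (X - f ` (L - U))"
      by (auto simp: openin_open Diff_eq)
    \<comment> \<open>This open set consists of the points whose whole fibre lies in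
      \<open>U\<close>. Off \<open>N\<close> the section picks a point of the fibre, so the set is
      null, and full support of \<mu> forces it to be empty.\<close>
    have "X - f ` (L - U) \<subseteq> N \<union> (h -` U \<inter> X)"
    proof
      fix x assume x: "x \<in> X - f ` (L - U)"
      show "x \<in> N \<union> (h -` U \<inter> X)"
      proof (cases "x \<in> N")
        case False
        then have "f (h x) = x" using fh x by simp
        then have "h x \<in> U" using x hL[of x] by (metis DiffD2 DiffI imageI)
        then show ?thesis using x by simp
      qed simp
    qed
    moreover have "X - f ` (L - U) \<in> sets \<mu>"
      using openin_sets_restrict_borel[OF op] D(3) by simp
    ultimately have "X - f ` (L - U) \<in> null_sets \<mu>"
      using null_sets_subset null_sets.Un[OF N(1) hU] by blast
    then have XU: "X - f ` (L - U) = {}" using D(7)[OF op] by (metis null_setsD1 less_irrefl)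
    \<comment> \<open>Each point of \<open>U\<close> now shares its fibre with a point outside
      \<open>U\<close>, whereas fibres off \<open>M\<close> are singletons. So \<open>U\<close>
      would be null for \<kappa>, which charges every nonempty open set.\<close>
    have "U \<subseteq> L \<inter> f -` M"
    proof
      fix l assume l: "l \<in> U"
      then have lL: "l \<in> L" using openin_imp_subset[OF U(1)] by auto
      then have "f l \<in> f ` (L - U)" using XU f(2) by blast
      then obtain l' where l': "l' \<in> L" "l' \<notin> U" "f l' = f l" by auto
      have "f l \<in> M"
      proof (rule ccontr)
        assume "f l \<notin> M"
        then have "l' = l" using l' lL by (intro inj_onD[OF inj l'(3)]) auto
        then show False using l l' by simp
      qed
      then show "l \<in> L \<inter> f -` M" using lL by simp
    qed
    moreover have "univ_null L s (L \<inter> f -` M)"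
      by (rule univ_null_vimage[OF f cT _ eq M]) (use TX in auto)
    ultimately have "U \<in> null_sets (completion \<kappa>)"
      using \<kappa> null_sets_completion_subset unfolding univ_null_def by blast
    moreover have "U \<in> sets \<kappa>"
      using openin_sets_restrict_borel[OF U(1)] erg_supp_measureD(3)[OF \<kappa>] by simp
    ultimately have "emeasure \<kappa> U = 0" by (auto simp: null_sets_def)
    then show False using erg_supp_measureD(7)[OF \<kappa> U] by simp
  qed
  have "erg_supp_measure L s ?\<nu>" unfolding erg_supp_measure_def
    using prob_space_distr[OF hm] inv erg supp sm spB
    by (auto cong: measurable_cong_sets)
  then have "Q \<in> null_sets (completion ?\<nu>)" using Q by (auto simp: univ_null_def)
  then obtain N' where N': "N' \<in> null_sets ?\<nu>" "Q \<subseteq> N'"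
    unfolding null_sets_completion_iff2 by blast
  then have "h -` N' \<inter> X \<in> null_sets \<mu>"
    using hm D(2) by (simp add: null_sets_distr_iff)
  then have "N \<union> (h -` N' \<inter> X) \<in> null_sets \<mu>" using N(1) by auto
  \<comment> \<open>If \<open>f q\<close> avoids \<open>N\<close>, then \<open>h (f q) = q\<close>,
    which lies in \<open>N'\<close>.\<close>
  moreover have "f ` Q \<subseteq> N \<union> (h -` N' \<inter> X)"
  proof
    fix x assume "x \<in> f ` Q"
    then obtain q where q: "q \<in> Q" "x = f q" by auto
    then have "q \<in> L" using Q by (auto simp: univ_null_def)
    then show "x \<in> N \<union> (h -` N' \<inter> X)" using q N'(2) hf f(2) by auto
  qed
  ultimately show "f ` Q \<in> null_sets (completion \<mu>)"
    unfolding null_sets_completion_iff2 by blast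
qed

section \<open>Inverse limits of invertible systems\<close>

text \<open>Coordinate zero determines the positive coordinates by iterating \<open>T\<close> and
  the negative ones by injectivity. Conversely, iterates of \<open>T\<close> and of a right inverse
  of it give a full orbit through any point.\<close>

lemma bij_betw_inv_lim_zero:
  assumes "T ` X = X" "inj_on T X"
  shows "bij_betw (\<lambda>z. z 0) (inv_lim X T) X"
  unfolding bij_betw_def
proof
  show "inj_on (\<lambda>z. z 0) (inv_lim X T)"
  proof (rule inj_onI)
    fix z w assume z: "z \<in> inv_lim X T" and w: "w \<in> inv_lim X T" and 0: "z 0 = w 0"
    have "z i = w i" for i
    proof (induction i rule: int_induct[of _ 0])
      case (step1 i)
      then show ?case using z w by (simp add: inv_lim_def)
    next
      case (step2 i)
      have "z ((i - 1) + 1) = T (z (i - 1))" "w ((i - 1) + 1) = T (w (i - 1))"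
        "z (i - 1) \<in> X" "w (i - 1) \<in> X"
        using z w unfolding inv_lim_def by blast+
      then show ?case using step2 inj_onD[OF assms(2)] by simp
    qed (rule 0)
    then show "z = w" by auto
  qed
  show "(\<lambda>z. z 0) ` inv_lim X T = X"
  proof
    show "X \<subseteq> (\<lambda>z. z 0) ` inv_lim X T"
    proof
      fix x assume x: "x \<in> X"
      define S where "S = inv_into X T"
      have S: "S y \<in> X" "T (S y) = y" if "y \<in> X" for y
        using that assms(1) unfolding S_def by (auto simp: inv_into_into f_inv_into_f)
      define z where "z i = (if i \<ge> 0 then (T ^^ nat i) x else (S ^^ nat (- i)) x)" for i
      have TX: "T y \<in> X" if "y \<in> X" for y using that assms(1) by blast
      have Tn: "(T ^^ n) x \<in> X" for n by (induction n) (auto intro: x TX)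
      have Sn: "(S ^^ n) x \<in> X" for n by (induction n) (auto intro: x S)
      have "z (i + 1) = T (z i)" for i
      proof (cases "i \<ge> 0")
        case True
        then have "nat (i + 1) = Suc (nat i)" by simp
        then show ?thesis using True by (simp add: z_def)
      next
        case False
        then have "nat (- i) = Suc (nat (- (i + 1)))" by simp
        then have "T (z i) = (S ^^ nat (- (i + 1))) x"
          using False S(2)[OF Sn] by (simp add: z_def)
        \<comment> \<open>At \<open>i = -1\<close> the definition of \<open>z\<close> changes
          branch; both branches give \<open>x\<close> at index zero.\<close>
        then show ?thesis using False by (cases "i = -1") (auto simp: z_def)
      qed
      then have "z \<in> inv_lim X T" using Tn Sn by (auto simp: inv_lim_def z_def)
      moreover have "z 0 = x" by (simp add: z_def)
      ultimately show "x \<in> (\<lambda>z. z 0) ` inv_lim X T" by force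
    qed
  qed (auto simp: inv_lim_def)
qed

lemma continuous_on_shift: "continuous_on Z (shift :: (int \<Rightarrow> 'a::topological_space) \<Rightarrow> _)"
  unfolding shift_def
  by (intro continuous_on_coordinatewise_then_product
      continuous_on_subset[OF continuous_on_product_coordinates] subset_UNIV)

text \<open>Replaces the inverse limit by \<open>X\<close>: the zeroth coordinate is a continuous
  bijection from a compact space, hence a homeomorphism, and it conjugates \<open>shift\<close> to
  \<open>T\<close>. The set \<open>M'\<close> is the copy of \<open>M\<close> in
  \<open>X\<close>.\<close>

lemma zero_coordinate_factor:
  fixes X :: "'a::metric_space set" and f :: "'l::topological_space \<Rightarrow> int \<Rightarrow> 'a"
  assumes X: "tds X T" "inj_on T X"
    and L: "compact L"
    and f: "continuous_on L f" "f ` L = inv_lim X T"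
    and eq: "\<And>l. l \<in> L \<Longrightarrow> f (s l) = shift (f l)"
    and M: "shift ` M = M" "univ_null (inv_lim X T) shift M"
    and inj: "inj_on f (L - f -` M)"
  obtains f' M' where "continuous_on L f'" "f' ` L = X"
    "\<And>l. l \<in> L \<Longrightarrow> f' (s l) = T (f' l)" "\<And>x. x \<in> X \<Longrightarrow> T x \<in> M' \<longleftrightarrow> x \<in> M'"
    "univ_null X T M'" "inj_on f' (L - f' -` M')"
proof -
  let ?p = "\<lambda>z :: int \<Rightarrow> 'a. z 0" and ?I = "inv_lim X T"
  have TX: "T ` X = X" using X by (simp add: tds_def)
  note bij = bij_betw_inv_lim_zero[OF TX X(2)]
  have cI: "compact ?I" using compact_continuous_image[OF f(1) L] f(2) by simp
  have cp: "continuous_on ?I ?p"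
    by (rule continuous_on_subset[OF continuous_on_product_coordinates subset_UNIV])
  obtain k where k: "homeomorphism ?I X ?p k"
    using homeomorphism_compact[OF cI cp] bij by (auto simp: bij_betw_def)
  have kI: "k ` X = ?I" and ck: "continuous_on X k" and pk: "\<And>x. x \<in> X \<Longrightarrow> k x 0 = x"
    and kp: "\<And>z. z \<in> ?I \<Longrightarrow> k (z 0) = z"
    using k by (auto simp: homeomorphism_def)
  have shI: "shift z \<in> ?I" "shift z 0 = T (z 0)" if "z \<in> ?I" for z
  proof -
    have "z (i + 1 + 1) = T (z (i + 1))" "z (i + 1) \<in> X" for i
      using that unfolding inv_lim_def by blast+
    then show "shift z \<in> ?I" by (simp add: inv_lim_def shift_def)
    have "z (0 + 1) = T (z 0)" using that unfolding inv_lim_def by blast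
    then show "shift z 0 = T (z 0)" by (simp add: shift_def)
  qed
  have kT: "k (T x) = shift (k x)" if "x \<in> X" for x
  proof -
    have "k x \<in> ?I" using kI that by blast
    then show ?thesis using shI[of "k x"] kp[of "shift (k x)"] pk[OF that] by simp
  qed
  \<comment> \<open>Injectivity turns the invariance of \<open>M\<close> as a set into the pointwise
    equivalence of \<open>shift z\<close> and \<open>z\<close> lying in \<open>M\<close>.\<close>
  have sh_inj: "inj (shift :: (int \<Rightarrow> 'a) \<Rightarrow> _)"
  proof (rule injI)
    fix z w :: "int \<Rightarrow> 'a" assume "shift z = shift w"
    then have "z (i - 1 + 1) = w (i - 1 + 1)" for i unfolding shift_def by metis
    then show "z = w" by auto
  qed
  define M' where "M' = X \<inter> k -` M"
  define f' where "f' l = f l 0" for l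
  have fI: "f l \<in> ?I" if "l \<in> L" for l using f(2) that by blast
  have f'M: "f' l \<in> M' \<longleftrightarrow> f l \<in> M" if "l \<in> L" for l
    using fI[OF that] kp[OF fI[OF that]] by (auto simp: f'_def M'_def inv_lim_def)
  show thesis
  proof
    show "continuous_on L f'"
      unfolding f'_def by (rule continuous_on_product_then_coordinatewise[OF f(1)])
    show "f' ` L = X"
      using f(2) bij image_image[of ?p f L] by (simp add: f'_def bij_betw_def)
    show "f' (s l) = T (f' l)" if "l \<in> L" for l
      using eq[OF that] shI(2)[OF fI[OF that]] by (simp add: f'_def)
    show "T x \<in> M' \<longleftrightarrow> x \<in> M'" if x: "x \<in> X" for x
    proof -
      have "shift (k x) \<in> M \<longleftrightarrow> k x \<in> M"
        using M(1) sh_inj by (metis inj_image_mem_iff)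
      then show ?thesis using x TX kT[OF x] by (auto simp: M'_def)
    qed
    show "univ_null X T M'"
      unfolding M'_def
      by (rule univ_null_vimage[OF ck kI continuous_on_shift _ kT M(2)]) (use shI in auto)
    show "inj_on f' (L - f' -` M')"
    proof (rule inj_onI)
      fix a b assume a: "a \<in> L - f' -` M'" and b: "b \<in> L - f' -` M'" and "f' a = f' b"
      then have "f a = f b" using kp fI unfolding f'_def by (metis DiffD1)
      then show "a = b" using a b f'M by (intro inj_onD[OF inj]) auto
    qed
  qed
qed

section \<open>The conjugacy through the Markov shift\<close>

theorem theorem3p2:
  fixes X :: "'a::metric_space set" and T :: "'a \<Rightarrow> 'a"
    and Y :: "'b::metric_space set" and S :: "'b \<Rightarrow> 'b"
  assumes "erg_supported X T" and "erg_supported Y S"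
    and "inj_on T X" and "inj_on S Y"
    and "almost_top_conj X T Y S"
  shows "\<exists>Xt Yt \<phi>. Xt \<subseteq> X \<and> T ` Xt = Xt \<and> Yt \<subseteq> Y \<and> S ` Yt = Yt \<and>
           (\<forall>\<mu>. erg_supp_measure X T \<mu> \<longrightarrow> X - Xt \<in> null_sets (completion \<mu>)) \<and>
           (\<forall>\<nu>. erg_supp_measure Y S \<nu> \<longrightarrow> Y - Yt \<in> null_sets (completion \<nu>)) \<and>
           (\<exists>\<psi>. homeomorphism Xt Yt \<phi> \<psi>) \<and>
           (\<forall>x \<in> Xt. \<phi> (T x) = S (\<phi> x))"
proof -
  from assms(5) obtain E fT fS M2 P2 where
    L0: "erg_supported (markov_shift E) shift"
    and fT: "continuous_on (markov_shift E) fT" "fT ` markov_shift E = inv_lim X T"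
    and fS: "continuous_on (markov_shift E) fS" "fS ` markov_shift E = inv_lim Y S"
    and eqT: "\<forall>x \<in> markov_shift E. fT (shift x) = shift (fT x)"
    and eqS: "\<forall>x \<in> markov_shift E. fS (shift x) = shift (fS x)"
    and M2: "shift ` M2 = M2" "univ_null (inv_lim X T) shift M2"
    and P2: "shift ` P2 = P2" "univ_null (inv_lim Y S) shift P2"
    and injT: "inj_on fT (markov_shift E - fT -` M2)"
    and injS: "inj_on fS (markov_shift E - fS -` P2)"
    unfolding almost_top_conj_def by (elim conjE exE) (rule that; assumption)
  define L where "L = markov_shift E"
  note L = L0[folded L_def]
  have cL: "compact L" and sL: "shift ` L = L"
    using L by (auto simp: erg_supported_def tds_def)
  have X: "tds X T" and Y: "tds Y S" using assms by (auto simp: erg_supported_def)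
  have TX: "T ` X = X" "continuous_on X T" and SY: "S ` Y = Y" "continuous_on Y S"
    using X Y by (auto simp: tds_def)
  obtain f M where f: "continuous_on L f" "f ` L = X"
    and eqf: "\<And>l. l \<in> L \<Longrightarrow> f (shift l) = T (f l)" and invM: "\<And>x. x \<in> X \<Longrightarrow> T x \<in> M \<longleftrightarrow> x \<in> M"
    and M: "univ_null X T M" and injf: "inj_on f (L - f -` M)"
    using zero_coordinate_factor[OF X assms(3) cL fT[folded L_def] eqT[folded L_def, rule_format] M2
        injT[folded L_def]] by blast
  obtain g P where g: "continuous_on L g" "g ` L = Y"
    and eqg: "\<And>l. l \<in> L \<Longrightarrow> g (shift l) = S (g l)" and invP: "\<And>y. y \<in> Y \<Longrightarrow> S y \<in> P \<longleftrightarrow> y \<in> P"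
    and P: "univ_null Y S P" and injg: "inj_on g (L - g -` P)"
    using zero_coordinate_factor[OF Y assms(4) cL fS[folded L_def] eqS[folded L_def, rule_format] P2
        injS[folded L_def]] by blast
  define G where "G = L - f -` M - g -` P"
  have GL: "G \<subseteq> L" by (auto simp: G_def)
  \<comment> \<open>The equivalence, rather than forward invariance alone, is what makes
    \<open>G\<close> equal to its image under the surjective \<open>shift\<close>; the images of
    \<open>G\<close> in \<open>X\<close> and \<open>Y\<close> inherit this.\<close>
  have memG: "shift l \<in> G \<longleftrightarrow> l \<in> G" if "l \<in> L" for l
  proof -
    have "shift l \<in> L" "f l \<in> X" "g l \<in> Y" using that sL f(2) g(2) by blast+
    then show ?thesis using that eqf invM eqg invP by (simp add: G_def)
  qed
  have sG: "shift ` G = G"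
  proof
    show "shift ` G \<subseteq> G" using memG GL by auto
    show "G \<subseteq> shift ` G"
    proof
      fix l assume l: "l \<in> G"
      then obtain l' where "l' \<in> L" "l = shift l'" using GL sL by blast
      then show "l \<in> shift ` G" using l memG by auto
    qed
  qed
  have Tf: "T ` f ` G = f ` G"
  proof -
    have "T ` f ` G = f ` shift ` G"
      unfolding image_image using eqf GL by (intro image_cong) auto
    then show ?thesis using sG by simp
  qed
  have Sg: "S ` g ` G = g ` G"
  proof -
    have "S ` g ` G = g ` shift ` G"
      unfolding image_image using eqg GL by (intro image_cong) auto
    then show ?thesis using sG by simp
  qed
  \<comment> \<open>Nullity of \<open>P\<close> travels from \<open>Y\<close> up to \<open>L\<close>
    along \<open>g\<close> and then down to \<open>X\<close> along \<open>f\<close>.\<close>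
  have "univ_null X T (f ` (L \<inter> g -` P))"
    by (rule univ_null_image[OF L X f eqf M injf
          univ_null_vimage[where k = g and T = shift, OF g SY(2) equalityD1[OF SY(1)] eqg P]])
  \<comment> \<open>A preimage in \<open>L\<close> of a point outside \<open>M\<close> avoids the
    preimage of \<open>M\<close>; if it is not in \<open>G\<close>, then \<open>g\<close> maps it
    into \<open>P\<close>.\<close>
  moreover have "X - f ` G \<subseteq> M \<union> f ` (L \<inter> g -` P)"
    using f(2) by (auto simp: G_def)
  ultimately have nullX: "X - f ` G \<in> null_sets (completion \<mu>)" if "erg_supp_measure X T \<mu>" for \<mu>
    using M that null_sets_completion_subset null_sets.Un unfolding univ_null_def by meson
  have "univ_null Y S (g ` (L \<inter> f -` M))"
    by (rule univ_null_image[OF L Y g eqg P injg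
          univ_null_vimage[where k = f and T = shift, OF f TX(2) equalityD1[OF TX(1)] eqf M]])
  moreover have "Y - g ` G \<subseteq> P \<union> g ` (L \<inter> f -` M)"
    using g(2) by (auto simp: G_def)
  ultimately have nullY: "Y - g ` G \<in> null_sets (completion \<nu>)" if "erg_supp_measure Y S \<nu>" for \<nu>
    using P that null_sets_completion_subset null_sets.Un unfolding univ_null_def by meson
  obtain f' where "homeomorphism (L - f -` M) (X - M) f f'"
    using homeomorphism_restrict_saturated[OF cL f injf] by blast
  then have hf: "homeomorphism G (f ` G) f f'"
    by (rule homeomorphism_of_subsets[OF _ _ subset_refl]) (auto simp: G_def)
  obtain g' where "homeomorphism (L - g -` P) (Y - P) g g'"
    using homeomorphism_restrict_saturated[OF cL g injg] by blast
  then have hg: "homeomorphism G (g ` G) g g'"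
    by (rule homeomorphism_of_subsets[OF _ _ subset_refl]) (auto simp: G_def)
  have hom: "homeomorphism (f ` G) (g ` G) (g \<circ> f') (f \<circ> g')"
    by (rule homeomorphism_compose[OF homeomorphism_symD[OF hf] hg])
  have "(g \<circ> f') (T x) = S ((g \<circ> f') x)" if "x \<in> f ` G" for x
  proof -
    from that obtain l where l: "l \<in> G" "x = f l" by auto
    have f': "f' (f a) = a" if "a \<in> G" for a using hf that by (simp add: homeomorphism_def)
    have "l \<in> L" using l GL by auto
    \<comment> \<open>\<open>T x = f (shift l)\<close> with \<open>shift l\<close> again in
      \<open>G\<close>, so \<open>f'\<close> sends it to \<open>shift l\<close>, and
      \<open>g\<close> is equivariant.\<close>
    then show ?thesis using l f' memG eqf eqg by (metis comp_apply)
  qed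
  moreover have "f ` G \<subseteq> X" "g ` G \<subseteq> Y" using GL f(2) g(2) by auto
  ultimately show ?thesis using Tf Sg nullX nullY hom by blast
qed

end
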